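(* Let $\Theta\subset\mathbb{R}^{n_\theta}$ and let $\theta^*\in\Theta$. Consider, for $\theta\in\Theta$, the system $$\dot x=A(\theta^* )x+B(\theta^* )u,\qquad \dot e=\Delta A(\theta)x+A(\theta)e+\Delta B(\theta)u,\qquad \Delta y=\Delta C(\theta)x+C(\theta)e+\Delta D(\theta)u,$$ with $x(0)=0$, $e(0)=0$. Suppose there exist a function $V:\mathbb{R}^n\times\mathbb{R}^n\times\mathbb{R}^{n_\theta}\to\mathbb{R}_{\ge0}$, $V(0,0,\cdot)=0$, $V\in\mathcal{C}^1$, and functions $\gamma_d:\mathbb{R}^{n_\theta}\to\mathbb{R}_{\ge0}$ and $\gamma_n:\mathbb{R}^{n_\theta}\to\mathbb{R}_{\ge0}$ such that, for all $\theta\in\Theta$, all $(x,e)\in\mathbb{R}^n\times\mathbb{R}^n$ and all $u\in\mathbb{R}^m$, $$V(x,e,\theta)\ge0,\qquad \dot V(x,e,\theta)\le-\gamma_d(\theta)(\Delta y)^T(\Delta y)+\gamma_n(\theta)u^Tu$$ along the trajectories of the system. Then, for every nonzero input $u\in\mathcal{L}_2$, $$\frac{\|\Delta y\|_2^2}{\|u\|_2^2}\le\gamma(\theta):=\frac{\gamma_n(\theta)}{\gamma_d(\theta)}$$ for all $\theta\in\Theta$ (for which the quotient is defined, i.e. $\gamma_d(\theta)\neq0$).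
   Context: The data are functions $A:\mathbb{R}^{n_\theta}\to\mathbb{R}^{n\times n}$, $B:\mathbb{R}^{n_\theta}\to\mathbb{R}^{n\times m}$, $C:\mathbb{R}^{n_\theta}\to\mathbb{R}^{p\times n}$, $D:\mathbb{R}^{n_\theta}\to\mathbb{R}^{p\times m}$ (no assumption on the form of the dependence on $\theta$), with $A(\theta)$ Hurwitz for all $\theta\in\Theta$. The fixed $\theta^*\in\Theta$ is the nominal parameter value, and $\Delta A(\theta):=A(\theta^* )-A(\theta)$, $\Delta B(\theta):=B(\theta^* )-B(\theta)$, $\Delta C(\theta):=C(\theta^* )-C(\theta)$, $\Delta D(\theta):=D(\theta^* )-D(\theta)$. The system arises from the nominal system $\dot x=A(\theta^* )x+B(\theta^* )u$, $y=C(\theta^* )x+D(\theta^* )u$ and the uncertain system $\dot{\tilde x}=A(\theta)\tilde x+B(\theta)u$, $\tilde y=C(\theta)\tilde x+D(\theta)u$, by setting $e=x-\tilde x$, $\Delta y=y-\tilde y$. Here $\dot V(x,e,\theta)=\frac{\partial V}{\partial x}\left(A(\theta^* )x+B(\theta^* )u\right)+\frac{\partial V}{\partial e}\left(\Delta A(\theta)x+A(\theta)e+\Delta B(\theta)u\right)$ is the derivative of $V$ along trajectories for the constant parameter $\theta$, and $\|w\|_2^2=\int_0^\infty w(t)^Tw(t)\,dt$. *)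

theory Defs
  imports "HOL-Analysis.Analysis"
begin

definition hurwitz :: "real^'n^'n \<Rightarrow> bool" where
  "hurwitz M \<longleftrightarrow>
     (\<forall>(l::complex) (v::complex^'n).
        v \<noteq> 0 \<and> (\<chi> i j. complex_of_real (M $ i $ j)) *v v = l *s v \<longrightarrow> Re l < 0)"

definition C1 :: "('a::real_normed_vector \<Rightarrow> 'b::real_normed_vector) \<Rightarrow> bool" where
  "C1 f \<longleftrightarrow>
     (\<exists>f'. (\<forall>z. (f has_derivative blinfun_apply (f' z)) (at z)) \<and> continuous_on UNIV f')"

text \<open>
  Inputs are only square-integrable, so differential equations are understood in the sense of
  Caratheodory: a solution on the half-line is absolutely continuous on every compact interval
  and satisfies the equation almost everywhere.

  In the definition of absolute continuity, \<open>\<D>\<close> is an arbitrary finite family of non-overlapping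
  compact subintervals of \<open>{a..b}\<close>.
\<close>

definition abs_continuous_on_interval ::
    "real \<Rightarrow> real \<Rightarrow> (real \<Rightarrow> 'a::real_normed_vector) \<Rightarrow> bool" where
  "abs_continuous_on_interval a b f \<longleftrightarrow>
     (\<forall>\<epsilon>>0. \<exists>\<delta>>0. \<forall>\<D>. \<D> division_of \<Union>\<D> \<and> \<Union>\<D> \<subseteq> {a..b} \<and> (\<Sum>K\<in>\<D>. Sup K - Inf K) < \<delta>
        \<longrightarrow> (\<Sum>K\<in>\<D>. norm (f (Sup K) - f (Inf K))) < \<epsilon>)"

definition caratheodory_solution ::
    "(real \<Rightarrow> 'a \<Rightarrow> 'a) \<Rightarrow> 'a::real_normed_vector \<Rightarrow> (real \<Rightarrow> 'a) \<Rightarrow> bool" where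
  "caratheodory_solution f x0 x \<longleftrightarrow>
     x 0 = x0 \<and>
     (\<forall>T\<ge>0. abs_continuous_on_interval 0 T x) \<and>
     (AE t in lebesgue. t > 0 \<longrightarrow> (x has_vector_derivative f t (x t)) (at t))"

text \<open>
  The squared norm takes values in the extended nonnegative reals: it is not known in advance
  that the output is square-integrable.
\<close>

definition L2_norm_sq :: "(real \<Rightarrow> 'a::euclidean_space) \<Rightarrow> ennreal" where
  "L2_norm_sq w = (\<integral>\<^sup>+t\<in>{0..}. ennreal (w t \<bullet> w t) \<partial>lebesgue)"

definition in_L2 :: "(real \<Rightarrow> 'a::euclidean_space) \<Rightarrow> bool" where
  "in_L2 w \<longleftrightarrow> set_borel_measurable lebesgue {0..} w \<and> L2_norm_sq w < \<infinity>"

definition zero_in_L2 :: "(real \<Rightarrow> 'a::euclidean_space) \<Rightarrow> bool" where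
  "zero_in_L2 w \<longleftrightarrow> (AE t in lebesgue. t \<ge> 0 \<longrightarrow> w t = 0)"

definition nominal_diff :: "('q \<Rightarrow> 'a::minus) \<Rightarrow> 'q \<Rightarrow> 'q \<Rightarrow> 'a" where
  "nominal_diff F \<theta>s \<theta> = F \<theta>s - F \<theta>"

definition nominal_rhs ::
    "('q \<Rightarrow> real^'n^'n) \<Rightarrow> ('q \<Rightarrow> real^'m^'n) \<Rightarrow> 'q \<Rightarrow> real^'n \<Rightarrow> real^'m \<Rightarrow> real^'n" where
  "nominal_rhs A B \<theta>s x u = A \<theta>s *v x + B \<theta>s *v u"

definition error_rhs ::
    "('q \<Rightarrow> real^'n^'n) \<Rightarrow> ('q \<Rightarrow> real^'m^'n) \<Rightarrow> 'q \<Rightarrow> 'q \<Rightarrow>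
     real^'n \<Rightarrow> real^'n \<Rightarrow> real^'m \<Rightarrow> real^'n" where
  "error_rhs A B \<theta>s \<theta> x e u =
     nominal_diff A \<theta>s \<theta> *v x + A \<theta> *v e + nominal_diff B \<theta>s \<theta> *v u"

definition output_error ::
    "('q \<Rightarrow> real^'n^'p) \<Rightarrow> ('q \<Rightarrow> real^'m^'p) \<Rightarrow> 'q \<Rightarrow> 'q \<Rightarrow>
     real^'n \<Rightarrow> real^'n \<Rightarrow> real^'m \<Rightarrow> real^'p" where
  "output_error C D \<theta>s \<theta> x e u =
     nominal_diff C \<theta>s \<theta> *v x + C \<theta> *v e + nominal_diff D \<theta>s \<theta> *v u"

definition V_dot ::
    "('q \<Rightarrow> real^'n^'n) \<Rightarrow> ('q \<Rightarrow> real^'m^'n) \<Rightarrow> 'q \<Rightarrow> ((real^'n) \<times> (real^'n) \<times> 'q \<Rightarrow> real) \<Rightarrow>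
     real^'n \<Rightarrow> real^'n \<Rightarrow> 'q \<Rightarrow> real^'m \<Rightarrow> real" where
  "V_dot A B \<theta>s V x e \<theta> u =
     frechet_derivative (\<lambda>x'. V (x', e, \<theta>)) (at x) (nominal_rhs A B \<theta>s x u) +
     frechet_derivative (\<lambda>e'. V (x, e', \<theta>)) (at e) (error_rhs A B \<theta>s \<theta> x e u)"

end

theory Submission
  imports Defs
begin

text \<open>
  This is the dissipation argument for an upper bound on a gain. Along a trajectory,
  \<open>W t = V (x t, e t, \<theta>) / \<gamma>d \<theta>\<close> is nonnegative, vanishes at \<open>0\<close>, and satisfies
  \<open>\<Delta>y t \<bullet> \<Delta>y t + W' t \<le> \<gamma> * (u t \<bullet> u t)\<close> for almost every \<open>t\<close>, where
  \<open>\<gamma> = \<gamma>n \<theta> / \<gamma>d \<theta>\<close>. Integrating over \<open>{0..T}\<close>, the storage term contributes \<open>W T - W 0 \<ge> 0\<close> and can be dropped; letting \<open>T\<close> tend to infinity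
  gives the bound on the energies. The lemma \<open>dissipation_inequality\<close> does this for real functions.

  The analytic content lies in integrating \<open>W'\<close>. Since the input is merely square-integrable,
  the trajectories are differentiable only almost everywhere, and an almost-everywhere
  derivative determines the increments of a function only if the function is absolutely
  continuous. Two facts are therefore needed: \<open>W\<close> is absolutely continuous, because a \<open>C1\<close>
  function is Lipschitz on the compact trajectory segment
  (\<open>abs_continuous_storage\<close>); and an absolutely continuous function is the integral of its
  almost-everywhere derivative (\<open>abs_continuous_fundamental_theorem\<close>). The latter is proved for
  the gauge integral, where integrability of the derivative comes out of the estimate itself.
\<close>

section \<open>Absolutely continuous functions\<close>

lemma abs_continuous_on_intervalE:
  assumes "abs_continuous_on_interval a b f" and "0 < \<epsilon>"
  obtains \<delta> where "0 < \<delta>" and "\<And>\<D>. \<lbrakk>\<D> division_of \<Union>\<D>; \<Union>\<D> \<subseteq> {a..b};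
      (\<Sum>K\<in>\<D>. Sup K - Inf K) < \<delta>\<rbrakk> \<Longrightarrow> (\<Sum>K\<in>\<D>. norm (f (Sup K) - f (Inf K))) < \<epsilon>"
proof -
  have "\<exists>\<delta>>0. \<forall>\<D>. \<D> division_of \<Union>\<D> \<and> \<Union>\<D> \<subseteq> {a..b} \<and> (\<Sum>K\<in>\<D>. Sup K - Inf K) < \<delta>
      \<longrightarrow> (\<Sum>K\<in>\<D>. norm (f (Sup K) - f (Inf K))) < \<epsilon>"
    by (rule assms(1)[unfolded abs_continuous_on_interval_def, rule_format, OF assms(2)])
  then obtain \<delta> where "0 < \<delta>" and \<delta>: "\<forall>\<D>. \<D> division_of \<Union>\<D> \<and> \<Union>\<D> \<subseteq> {a..b} \<and>
      (\<Sum>K\<in>\<D>. Sup K - Inf K) < \<delta> \<longrightarrow> (\<Sum>K\<in>\<D>. norm (f (Sup K) - f (Inf K))) < \<epsilon>"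
    by (elim exE conjE)
  show thesis
    by (rule that[OF \<open>0 < \<delta>\<close> \<delta>[rule_format]]) auto
qed

lemma abs_continuous_on_interval_imp_continuous_on:
  fixes f :: "real \<Rightarrow> 'a::real_normed_vector"
  assumes "abs_continuous_on_interval a b f"
  shows "continuous_on {a..b} f"
  unfolding continuous_on_iff
proof (intro ballI allI impI)
  fix t \<epsilon> :: real
  assume t: "t \<in> {a..b}" and "0 < \<epsilon>"
  then obtain \<delta> where "0 < \<delta>" and \<delta>: "\<And>\<D>. \<lbrakk>\<D> division_of \<Union>\<D>; \<Union>\<D> \<subseteq> {a..b};
      (\<Sum>K\<in>\<D>. Sup K - Inf K) < \<delta>\<rbrakk> \<Longrightarrow> (\<Sum>K\<in>\<D>. norm (f (Sup K) - f (Inf K))) < \<epsilon>"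
    using abs_continuous_on_intervalE[OF assms] by blast
  have close: "norm (f v - f u) < \<epsilon>" if "u \<le> v" "v - u < \<delta>" "u \<in> {a..b}" "v \<in> {a..b}" for u v
  proof -
    have "{{u..v}} division_of \<Union>{{u..v}}"
      using division_of_self[of u v] that by simp
    from \<delta>[OF this] show ?thesis
      using that by simp
  qed
  have "dist (f s) (f t) < \<epsilon>" if "s \<in> {a..b}" "dist s t < \<delta>" for s
    using close[of s t] close[of t s] that t
    by (cases "s \<le> t") (auto simp: dist_norm norm_minus_commute)
  then show "\<exists>\<delta>>0. \<forall>s\<in>{a..b}. dist s t < \<delta> \<longrightarrow> dist (f s) (f t) < \<epsilon>"
    using \<open>0 < \<delta>\<close> by blast
qed

text \<open>
  Absolute continuity only sees the sizes of increments, so it passes to any function whose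
  increments are controlled linearly. Two controlling functions are allowed because the storage
  depends on two trajectories.
\<close>

lemma abs_continuous_on_interval_dominated:
  fixes f :: "real \<Rightarrow> 'a::real_normed_vector" and g :: "real \<Rightarrow> 'b::real_normed_vector"
    and h :: "real \<Rightarrow> 'c::real_normed_vector"
  assumes f: "abs_continuous_on_interval a b f" and g: "abs_continuous_on_interval a b g"
    and dom: "\<And>s t. \<lbrakk>s \<in> {a..b}; t \<in> {a..b}\<rbrakk>
               \<Longrightarrow> norm (h s - h t) \<le> L * (norm (f s - f t) + norm (g s - g t))"
  shows "abs_continuous_on_interval a b h"
  unfolding abs_continuous_on_interval_def
proof (intro allI impI)
  fix \<epsilon> :: real
  assume "0 < \<epsilon>"
  define M where "M = \<bar>L\<bar> + 1"
  have "0 < M" and "L \<le> M"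
    by (auto simp: M_def)
  define \<epsilon>' where "\<epsilon>' = \<epsilon> / (2 * M)"
  have "0 < \<epsilon>'"
    using \<open>0 < \<epsilon>\<close> \<open>0 < M\<close> by (simp add: \<epsilon>'_def)
  obtain \<delta>1 where "0 < \<delta>1" and \<delta>1: "\<And>\<D>. \<lbrakk>\<D> division_of \<Union>\<D>; \<Union>\<D> \<subseteq> {a..b};
      (\<Sum>K\<in>\<D>. Sup K - Inf K) < \<delta>1\<rbrakk> \<Longrightarrow> (\<Sum>K\<in>\<D>. norm (f (Sup K) - f (Inf K))) < \<epsilon>'"
    using abs_continuous_on_intervalE[OF f \<open>0 < \<epsilon>'\<close>] by blast
  obtain \<delta>2 where "0 < \<delta>2" and \<delta>2: "\<And>\<D>. \<lbrakk>\<D> division_of \<Union>\<D>; \<Union>\<D> \<subseteq> {a..b};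
      (\<Sum>K\<in>\<D>. Sup K - Inf K) < \<delta>2\<rbrakk> \<Longrightarrow> (\<Sum>K\<in>\<D>. norm (g (Sup K) - g (Inf K))) < \<epsilon>'"
    using abs_continuous_on_intervalE[OF g \<open>0 < \<epsilon>'\<close>] by blast
  have "(\<Sum>K\<in>\<D>. norm (h (Sup K) - h (Inf K))) < \<epsilon>"
    if \<D>: "\<D> division_of \<Union>\<D>" "\<Union>\<D> \<subseteq> {a..b}" and small: "(\<Sum>K\<in>\<D>. Sup K - Inf K) < min \<delta>1 \<delta>2" for \<D>
  proof -
    have ends: "Sup K \<in> {a..b}" "Inf K \<in> {a..b}" if "K \<in> \<D>" for K
    proof -
      have "K \<noteq> {}" "K \<subseteq> {a..b}"
        using division_ofD(3)[OF \<D>(1) that] \<D>(2) that by auto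
      moreover obtain u v where "K = {u..v}"
        using division_ofD(4)[OF \<D>(1) \<open>K \<in> \<D>\<close>] by auto
      ultimately show "Sup K \<in> {a..b}" "Inf K \<in> {a..b}"
        by auto
    qed
    have "(\<Sum>K\<in>\<D>. norm (h (Sup K) - h (Inf K)))
        \<le> (\<Sum>K\<in>\<D>. M * (norm (f (Sup K) - f (Inf K)) + norm (g (Sup K) - g (Inf K))))"
    proof (rule sum_mono)
      fix K assume "K \<in> \<D>"
      have "L * (norm (f (Sup K) - f (Inf K)) + norm (g (Sup K) - g (Inf K)))
          \<le> M * (norm (f (Sup K) - f (Inf K)) + norm (g (Sup K) - g (Inf K)))"
        using \<open>L \<le> M\<close> by (intro mult_right_mono) auto
      then show "norm (h (Sup K) - h (Inf K))
          \<le> M * (norm (f (Sup K) - f (Inf K)) + norm (g (Sup K) - g (Inf K)))"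
        using dom[OF ends[OF \<open>K \<in> \<D>\<close>]] by linarith
    qed
    also have "\<dots> = M * ((\<Sum>K\<in>\<D>. norm (f (Sup K) - f (Inf K)))
        + (\<Sum>K\<in>\<D>. norm (g (Sup K) - g (Inf K))))"
      by (simp add: sum_distrib_left sum.distrib distrib_left)
    also have "\<dots> < M * (\<epsilon>' + \<epsilon>')"
      using \<delta>1[OF \<D>] \<delta>2[OF \<D>] small \<open>0 < M\<close> by (intro mult_strict_left_mono add_strict_mono) auto
    also have "\<dots> = \<epsilon>"
      using \<open>0 < M\<close> by (simp add: \<epsilon>'_def field_simps)
    finally show ?thesis .
  qed
  then show "\<exists>\<delta>>0. \<forall>\<D>. \<D> division_of \<Union>\<D> \<and> \<Union>\<D> \<subseteq> {a..b} \<and> (\<Sum>K\<in>\<D>. Sup K - Inf K) < \<delta>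
        \<longrightarrow> (\<Sum>K\<in>\<D>. norm (h (Sup K) - h (Inf K))) < \<epsilon>"
    using \<open>0 < \<delta>1\<close> \<open>0 < \<delta>2\<close> by (intro exI[of _ "min \<delta>1 \<delta>2"]) auto
qed

text \<open>
  The set is enlarged to a closed ball: there the derivative is bounded by compactness, and
  convexity makes the mean value inequality applicable.
\<close>

lemma C1_lipschitz_on_bounded:
  fixes f :: "'a::euclidean_space \<Rightarrow> 'b::real_normed_vector"
  assumes "C1 f" and "bounded S"
  obtains L where "\<And>x y. \<lbrakk>x \<in> S; y \<in> S\<rbrakk> \<Longrightarrow> norm (f x - f y) \<le> L * norm (x - y)"
proof -
  obtain f' where f': "\<And>z. (f has_derivative blinfun_apply (f' z)) (at z)"
    and cont: "continuous_on UNIV f'"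
    using \<open>C1 f\<close> unfolding C1_def by blast
  obtain R where "\<forall>x\<in>S. norm x \<le> R"
    using \<open>bounded S\<close> unfolding bounded_iff ..
  then have R: "S \<subseteq> cball 0 R"
    by auto
  have "compact (f' ` cball 0 R)"
    by (intro compact_continuous_image continuous_on_subset[OF cont]) auto
  then obtain L where L: "\<And>z. z \<in> cball 0 R \<Longrightarrow> norm (f' z) \<le> L"
    using compact_imp_bounded bounded_iff by (metis imageI)
  have "norm (f x - f y) \<le> L * norm (x - y)" if "x \<in> S" "y \<in> S" for x y
  proof (rule differentiable_bound[of "cball 0 R" f "\<lambda>z. blinfun_apply (f' z)"])
    show "(f has_derivative blinfun_apply (f' z)) (at z within cball 0 R)" for z
      using f' has_derivative_at_withinI by blast
    show "onorm (blinfun_apply (f' z)) \<le> L" if "z \<in> cball 0 R" for z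
      using L[OF that] by (simp add: norm_blinfun.rep_eq)
  qed (use that R in auto)
  then show ?thesis
    using that by blast
qed

section \<open>The fundamental theorem of calculus for absolutely continuous functions\<close>

text \<open>
  The two endpoint errors add up to at most \<open>\<eta> * (v - u)\<close> because \<open>t\<close> lies between \<open>u\<close> and \<open>v\<close>;
  this is why gauge integrals, whose tags lie in their intervals, recover derivatives.
\<close>

lemma straddle_bound:
  fixes f :: "real \<Rightarrow> 'a::real_normed_vector"
  assumes t: "t \<in> {u..v}"
    and near: "\<And>y. y \<in> {u..v} \<Longrightarrow> norm (f y - f t - (y - t) *\<^sub>R d) \<le> \<eta> * norm (y - t)"
  shows "norm ((v - u) *\<^sub>R d - (f v - f u)) \<le> \<eta> * (v - u)"
proof -
  have "norm ((v - u) *\<^sub>R d - (f v - f u))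
      = norm ((f u - f t - (u - t) *\<^sub>R d) - (f v - f t - (v - t) *\<^sub>R d))"
    by (simp add: algebra_simps)
  also have "\<dots> \<le> \<eta> * norm (u - t) + \<eta> * norm (v - t)"
    by (rule norm_triangle_le_diff[OF add_mono[OF near near]]) (use t in auto)
  also have "\<dots> = \<eta> * (v - u)"
    using t by (simp add: algebra_simps)
  finally show ?thesis .
qed

lemma negligible_open_cover:
  assumes "negligible N" and "0 < \<delta>"
  obtains G where "open G" "N \<subseteq> G" "G \<in> lmeasurable" "measure lebesgue G < \<delta>"
proof -
  have N: "N \<in> null_sets lebesgue"
    using \<open>negligible N\<close> by (simp add: negligible_iff_null_sets)
  then obtain G where G: "open G" "N \<subseteq> G" "G - N \<in> lmeasurable"
      "emeasure lebesgue (G - N) < ennreal \<delta>"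
    using sets_lebesgue_outer_open[of N \<delta>] \<open>0 < \<delta>\<close> by blast
  have eq: "emeasure lebesgue G = emeasure lebesgue (G - N)"
    using emeasure_Diff_null_set[OF N, of G] G(1) by simp
  then have "emeasure lebesgue G < ennreal \<delta>"
    using G by simp
  moreover from this have "G \<in> lmeasurable"
    using G(1) by (intro fmeasurableI) (auto simp: top.not_eq_extremum intro: less_trans)
  ultimately show ?thesis
    using that[of G] G \<open>0 < \<delta>\<close> by (simp add: emeasure_eq_measure2 ennreal_less_iff)
qed

text \<open>
  For a fine tagged division, the Riemann sum of \<open>f'\<close> and the telescoping sum of increments of \<open>f\<close>
  are compared interval by interval. At tags outside \<open>N\<close>, differentiability gives an error
  proportional to the length. The derivative may be set to \<open>0\<close> on the null set \<open>N\<close>, so that the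
  intervals tagged in \<open>N\<close> contribute only increments of \<open>f\<close>. The gauge confines these
  intervals to an open set of small measure around \<open>N\<close>; their total length is thus small, and
  absolute continuity bounds the total increment.
\<close>

lemma abs_continuous_fundamental_theorem:
  fixes f :: "real \<Rightarrow> 'a::banach"
  assumes "a \<le> b" and ac: "abs_continuous_on_interval a b f" and N: "negligible N"
    and deriv: "\<And>t. t \<in> {a..b} - N \<Longrightarrow> (f has_vector_derivative f' t) (at t within {a..b})"
  shows "(f' has_integral (f b - f a)) {a..b}"
proof (cases "a = b")
  case True
  then show ?thesis by auto
next
  case False
  then have "a < b"
    using \<open>a \<le> b\<close> by simp
  define g where "g t = (if t \<in> N then 0 else f' t)" for t
  have "(g has_integral (f b - f a)) {a..b}"
    unfolding has_integral_factor_content_real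
  proof (intro allI impI)
    fix e :: real
    assume "0 < e"
    define \<eta> where "\<eta> = e / 2"
    have "0 < \<eta>" "0 < \<eta> * (b - a)"
      using \<open>0 < e\<close> \<open>a < b\<close> by (auto simp: \<eta>_def)
    obtain \<delta> where "0 < \<delta>" and \<delta>: "\<And>\<D>. \<lbrakk>\<D> division_of \<Union>\<D>; \<Union>\<D> \<subseteq> {a..b};
        (\<Sum>K\<in>\<D>. Sup K - Inf K) < \<delta>\<rbrakk> \<Longrightarrow> (\<Sum>K\<in>\<D>. norm (f (Sup K) - f (Inf K))) < \<eta> * (b - a)"
      using abs_continuous_on_intervalE[OF ac \<open>0 < \<eta> * (b - a)\<close>] by blast
    obtain G where G: "open G" "N \<subseteq> G" "G \<in> lmeasurable" "measure lebesgue G < \<delta>"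
      using negligible_open_cover[OF N \<open>0 < \<delta>\<close>] by blast
    have "\<exists>d>0. (t \<in> N \<longrightarrow> ball t d \<subseteq> G) \<and> (t \<in> {a..b} - N \<longrightarrow> (\<forall>y\<in>{a..b}.
        norm (y - t) < d \<longrightarrow> norm (f y - f t - (y - t) *\<^sub>R f' t) \<le> \<eta> * norm (y - t)))" for t
    proof (cases "t \<in> N")
      case True
      then show ?thesis
        using G(1,2) open_contains_ball by blast
    next
      case False
      then show ?thesis
        using deriv[of t] \<open>0 < \<eta>\<close>
        unfolding has_vector_derivative_def has_derivative_within_alt
        by (cases "t \<in> {a..b}") (auto intro: exI[of _ 1])
    qed
    then obtain d where d: "\<And>t. 0 < d t"
      and bad: "\<And>t. t \<in> N \<Longrightarrow> ball t (d t) \<subseteq> G"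
      and good: "\<And>t y. \<lbrakk>t \<in> {a..b} - N; y \<in> {a..b}; norm (y - t) < d t\<rbrakk>
                  \<Longrightarrow> norm (f y - f t - (y - t) *\<^sub>R f' t) \<le> \<eta> * norm (y - t)"
      by metis
    show "\<exists>\<gamma>. gauge \<gamma> \<and> (\<forall>p. p tagged_division_of {a..b} \<and> \<gamma> fine p \<longrightarrow>
      norm ((\<Sum>(t, K)\<in>p. measure lborel K *\<^sub>R g t) - (f b - f a)) \<le> e * measure lborel {a..b})"
    proof (intro exI conjI allI impI)
      show "gauge (\<lambda>t. ball t (d t))"
        using d gauge_ball_dependent by blast
      fix p
      assume "p tagged_division_of {a..b} \<and> (\<lambda>t. ball t (d t)) fine p"
      then have p: "p tagged_division_of {a..b}" and fine: "\<And>t K. (t, K) \<in> p \<Longrightarrow> K \<subseteq> ball t (d t)"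
        by (auto simp: fine_def)
      have "finite p"
        using p by blast
      define q where "q = {(t, K) \<in> p. t \<in> N}"
      have "q \<subseteq> p"
        by (auto simp: q_def)
      then have "finite q"
        using \<open>finite p\<close> finite_subset by blast
      have interval: "\<exists>u v. K = {u..v} \<and> u \<le> v \<and> t \<in> {u..v} \<and> {u..v} \<subseteq> {a..b}" if "(t, K) \<in> p" for t K
      proof -
        obtain u v where "K = cbox u v"
          using tagged_division_ofD(4)[OF p \<open>(t, K) \<in> p\<close>] by blast
        then show ?thesis
          using tagged_division_ofD(2,3)[OF p that] by (intro exI[of _ u] exI[of _ v]) auto
      qed
      have good_part: "norm (\<Sum>(t, K)\<in>p - q. measure lborel K *\<^sub>R g t - (f (Sup K) - f (Inf K))) \<le> \<eta> * (b - a)"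
      proof -
        have "norm (\<Sum>(t, K)\<in>p - q. measure lborel K *\<^sub>R g t - (f (Sup K) - f (Inf K)))
            \<le> (\<Sum>(t, K)\<in>p - q. \<eta> * (Sup K - Inf K))"
        proof (rule sum_norm_le, safe)
          fix t K
          assume tK: "(t, K) \<in> p" "(t, K) \<notin> q"
          then have "t \<notin> N"
            by (auto simp: q_def)
          obtain u v where K: "K = {u..v}" "u \<le> v" "t \<in> {u..v}" "{u..v} \<subseteq> {a..b}"
            using interval tK by blast
          have "norm ((v - u) *\<^sub>R f' t - (f v - f u)) \<le> \<eta> * (v - u)"
          proof (rule straddle_bound[OF K(3)])
            fix y assume "y \<in> {u..v}"
            then have "y \<in> ball t (d t)"
              using fine[OF tK(1)] K(1) by blast
            then show "norm (f y - f t - (y - t) *\<^sub>R f' t) \<le> \<eta> * norm (y - t)"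
              using good[of t y] \<open>t \<notin> N\<close> K \<open>y \<in> {u..v}\<close> by (auto simp: dist_norm norm_minus_commute)
          qed
          then show "norm (measure lborel K *\<^sub>R g t - (f (Sup K) - f (Inf K))) \<le> \<eta> * (Sup K - Inf K)"
            using K \<open>t \<notin> N\<close> by (simp add: g_def)
        qed
        also have "\<dots> \<le> (\<Sum>(t, K)\<in>p. \<eta> * (Sup K - Inf K))"
        proof (rule sum_mono2[OF \<open>finite p\<close>])
          show "0 \<le> (case z of (t, K) \<Rightarrow> \<eta> * (Sup K - Inf K))" if "z \<in> p - (p - q)" for z
            using that interval[of "fst z" "snd z"] \<open>0 < \<eta>\<close> by (auto simp: split_def)
        qed auto
        also have "\<dots> = \<eta> * (b - a)"
          using additive_tagged_division_1[OF \<open>a \<le> b\<close> p, of "\<lambda>t. t"]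
          by (simp add: split_def flip: sum_distrib_left)
        finally show ?thesis .
      qed
      have bad_part: "norm (\<Sum>(t, K)\<in>q. measure lborel K *\<^sub>R g t - (f (Sup K) - f (Inf K))) \<le> \<eta> * (b - a)"
      proof -
        let ?\<D> = "snd ` q"
        have div: "?\<D> division_of \<Union>?\<D>"
          by (metis \<open>q \<subseteq> p\<close> division_of_subset division_of_tagged_division division_of_union_self image_mono p)
        have sub: "\<Union>?\<D> \<subseteq> {a..b}"
          using interval \<open>q \<subseteq> p\<close> by fastforce
        have "\<Union>?\<D> \<subseteq> G"
          using fine bad by (fastforce simp: q_def)
        have "(\<Sum>K\<in>?\<D>. Sup K - Inf K) = (\<Sum>K\<in>?\<D>. measure lebesgue K)"
          using interval \<open>q \<subseteq> p\<close> by (intro sum.cong) fastforce+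
        also have "\<dots> = measure lebesgue (\<Union>?\<D>)"
          by (rule content_division[OF div])
        also have "\<dots> \<le> measure lebesgue G"
          by (rule measure_mono_fmeasurable[OF \<open>\<Union>?\<D> \<subseteq> G\<close>]) (use lmeasurable_division[OF div] G(3) in auto)
        finally have "(\<Sum>K\<in>?\<D>. Sup K - Inf K) < \<delta>"
          using G(4) by simp
        from \<delta>[OF div sub this]
        have small: "(\<Sum>K\<in>?\<D>. norm (f (Sup K) - f (Inf K))) < \<eta> * (b - a)" .
        have q: "q tagged_division_of \<Union>?\<D>"
          using tagged_partial_division_of_Union_self tagged_partial_division_subset \<open>q \<subseteq> p\<close> p
            tagged_division_of_def by metis
        \<comment> \<open>Different tags may share a degenerate interval, so passing from tagged intervals to
          intervals needs summands that vanish on degenerate intervals. The case distinction covers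
          the empty interval, where \<open>Sup\<close> and \<open>Inf\<close> are unspecified.\<close>
        have "norm (\<Sum>(t, K)\<in>q. measure lborel K *\<^sub>R g t - (f (Sup K) - f (Inf K)))
            \<le> (\<Sum>(t, K)\<in>q. norm (f (Sup K) - f (Inf K)))"
          by (rule sum_norm_le) (auto simp: q_def g_def norm_minus_commute)
        also have "\<dots> = (\<Sum>(t, K)\<in>q. if K = {} then 0 else norm (f (Sup K) - f (Inf K)))"
          using interval \<open>q \<subseteq> p\<close> by (intro sum.cong) fastforce+
        also have "\<dots> = (\<Sum>K\<in>?\<D>. if K = {} then 0 else norm (f (Sup K) - f (Inf K)))"
          by (rule sum.over_tagged_division_lemma[OF q])
             (auto simp: not_less le_less)
        also have "\<dots> = (\<Sum>K\<in>?\<D>. norm (f (Sup K) - f (Inf K)))"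
          using interval \<open>q \<subseteq> p\<close> by (intro sum.cong) fastforce+
        finally show ?thesis
          using small by linarith
      qed
      have "(\<Sum>(t, K)\<in>p. measure lborel K *\<^sub>R g t) - (f b - f a)
          = (\<Sum>(t, K)\<in>p. measure lborel K *\<^sub>R g t - (f (Sup K) - f (Inf K)))"
        using additive_tagged_division_1[OF \<open>a \<le> b\<close> p, of f] by (simp add: split_def sum_subtractf)
      also have "\<dots> = (\<Sum>(t, K)\<in>p - q. measure lborel K *\<^sub>R g t - (f (Sup K) - f (Inf K)))
          + (\<Sum>(t, K)\<in>q. measure lborel K *\<^sub>R g t - (f (Sup K) - f (Inf K)))"
        by (rule sum.subset_diff[OF \<open>q \<subseteq> p\<close> \<open>finite p\<close>])
      also have "norm \<dots> \<le> \<eta> * (b - a) + \<eta> * (b - a)"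
        using norm_triangle_mono[OF good_part bad_part] .
      finally show "norm ((\<Sum>(t, K)\<in>p. measure lborel K *\<^sub>R g t) - (f b - f a)) \<le> e * measure lborel {a..b}"
        using \<open>a \<le> b\<close> by (simp add: \<eta>_def field_simps)
    qed
  qed
  then show ?thesis
    by (rule has_integral_spike[OF N, rotated]) (simp add: g_def)
qed

section \<open>The integrated dissipation inequality\<close>

text \<open>
  The supply surplus \<open>g = r - W'\<close> dominates \<open>s \<ge> 0\<close> almost everywhere on the half-line, and its
  integral over \<open>{0..n}\<close> is \<open>\<integral> r - W n\<close>, hence at most the total supply \<open>\<integral> r\<close>. Monotone convergence
  is applied to \<open>g\<close> and not to \<open>s\<close>: being gauge integrable, \<open>g\<close> is measurable, whereas \<open>s\<close> is an
  arbitrary nonnegative function.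
\<close>

lemma dissipation_inequality:
  fixes W W' s r :: "real \<Rightarrow> real"
  assumes ac: "\<And>T. 0 \<le> T \<Longrightarrow> abs_continuous_on_interval 0 T W"
    and W0: "W 0 = 0" and W_nonneg: "\<And>t. 0 \<le> W t"
    and s_nonneg: "\<And>t. 0 \<le> s t" and r_nonneg: "\<And>t. 0 \<le> r t"
    and r_meas: "set_borel_measurable lebesgue {0..} r"
    and diss: "AE t in lebesgue. 0 < t \<longrightarrow>
                 (W has_vector_derivative W' t) (at t) \<and> s t + W' t \<le> r t"
  shows "(\<integral>\<^sup>+t\<in>{0..}. ennreal (s t) \<partial>lebesgue) \<le> (\<integral>\<^sup>+t\<in>{0..}. ennreal (r t) \<partial>lebesgue)"
proof (cases "(\<integral>\<^sup>+t\<in>{0..}. ennreal (r t) \<partial>lebesgue) = top")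
  case True
  then show ?thesis by simp
next
  case False
  define r0 where "r0 t = indicator {0..} t * r t" for t
  have "(\<integral>\<^sup>+t\<in>{0..}. ennreal (r t) \<partial>lebesgue) = (\<integral>\<^sup>+t. ennreal (r0 t) \<partial>lebesgue)"
    by (intro nn_integral_cong) (auto simp: r0_def indicator_def)
  then obtain I where "0 \<le> I" and I: "(\<integral>\<^sup>+t\<in>{0..}. ennreal (r t) \<partial>lebesgue) = ennreal I"
    and I0: "(\<integral>\<^sup>+t. ennreal (r0 t) \<partial>lebesgue) = ennreal I"
    using False by (metis ennreal_cases)
  have r0_int: "(r0 has_integral I) UNIV"
    using r_meas r_nonneg I0 \<open>0 \<le> I\<close>
    by (subst has_integral_iff_nn_integral_lebesgue) (auto simp: r0_def[abs_def] set_borel_measurable_def)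
  obtain N0 where N0: "N0 \<in> null_sets lebesgue"
    and diss_N0: "\<And>t. \<lbrakk>t \<notin> N0; 0 < t\<rbrakk> \<Longrightarrow> (W has_vector_derivative W' t) (at t) \<and> s t + W' t \<le> r t"
    using AE_E3[OF diss] by auto
  \<comment> \<open>The hypothesis says nothing about \<open>t = 0\<close>, so this point joins the exceptional set.\<close>
  define N where "N = insert 0 N0"
  have N: "negligible N"
    using N0 by (simp add: N_def negligible_iff_null_sets)
  \<comment> \<open>The value \<open>0\<close> on the exceptional set makes \<open>g\<close> nonnegative everywhere.\<close>
  define g where "g t = (if t \<in> N \<or> t < 0 then 0 else r t - W' t)" for t
  have s_le_g: "s t \<le> g t" if "t \<notin> N" "0 \<le> t" for t
    using that diss_N0[of t] by (auto simp: g_def N_def)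
  have g_nonneg: "0 \<le> g t" for t
    using s_le_g[of t] s_nonneg[of t] by (auto simp: g_def)
  have g_int: "\<exists>J. J \<le> I \<and> (g has_integral J) {0..real n}" for n
  proof -
    have "(W' has_integral (W n - W 0)) {0..real n}"
    proof (rule abs_continuous_fundamental_theorem[OF _ ac N])
      show "(W has_vector_derivative W' t) (at t within {0..real n})" if "t \<in> {0..real n} - N" for t
        using that diss_N0[of t] by (auto simp: N_def intro: has_vector_derivative_at_within)
    qed auto
    moreover obtain J where J: "(r0 has_integral J) {0..real n}"
      using integrable_on_subinterval[of r0 UNIV 0 "real n"] r0_int
      by (auto simp: integrable_on_def)
    ultimately have "((\<lambda>t. r0 t - W' t) has_integral (J - (W n - W 0))) {0..real n}"
      by (intro has_integral_diff)
    then have "(g has_integral (J - (W n - W 0))) {0..real n}"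
      by (rule has_integral_spike[OF N, rotated]) (auto simp: g_def r0_def)
    moreover have "J \<le> I"
      using r_nonneg by (intro has_integral_subset_le[OF _ J r0_int]) (auto simp: r0_def)
    ultimately show ?thesis
      using W0 W_nonneg[of n] by (intro exI[of _ "J - (W n - W 0)"]) auto
  qed
  define h where "h n t = ennreal (g t) * indicator {0..real n} t" for n t
  have h_int: "integral\<^sup>N lebesgue (h n) \<le> ennreal I" for n
  proof -
    obtain J where J: "J \<le> I" "(g has_integral J) {0..real n}"
      using g_int by blast
    then show ?thesis
      using nn_integral_has_integral_lebesgue'[OF g_nonneg J(2)]
      by (simp add: h_def[abs_def] nn_integral_completion ennreal_leI)
  qed
  have h_meas: "h n \<in> borel_measurable lebesgue" for n
  proof -
    obtain J where "(g has_integral J) {0..real n}"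
      using g_int by blast
    from has_integral_implies_lebesgue_measurable_real[OF this]
    have "(\<lambda>t. ennreal (g t * indicator {0..real n} t)) \<in> borel_measurable lebesgue"
      by simp
    also have "(\<lambda>t. ennreal (g t * indicator {0..real n} t)) = h n"
      by (auto simp: h_def indicator_def)
    finally show ?thesis .
  qed
  have "incseq h"
    by (auto simp: incseq_def le_fun_def h_def indicator_def)
  have "(\<integral>\<^sup>+t\<in>{0..}. ennreal (s t) \<partial>lebesgue) \<le> (\<integral>\<^sup>+t. (SUP n. h n t) \<partial>lebesgue)"
  proof (rule nn_integral_mono_AE)
    have "AE t in lebesgue. t \<notin> N"
      using N by (intro AE_not_in) (simp add: negligible_iff_null_sets)
    then show "AE t in lebesgue. ennreal (s t) * indicator {0..} t \<le> (SUP n. h n t)"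
    proof eventually_elim
      case (elim t)
      obtain n where n: "t \<le> real n"
        using real_arch_simple by blast
      have "ennreal (s t) * indicator {0..} t \<le> h n t"
        using s_le_g[OF elim] n by (auto simp: h_def indicator_def intro: ennreal_leI)
      also have "\<dots> \<le> (SUP n. h n t)"
        by (rule SUP_upper) simp
      finally show ?case .
    qed
  qed
  also have "\<dots> = (SUP n. integral\<^sup>N lebesgue (h n))"
    by (rule nn_integral_monotone_convergence_SUP[OF \<open>incseq h\<close> h_meas])
  also have "\<dots> \<le> ennreal I"
    by (rule SUP_least) (rule h_int)
  finally show ?thesis
    by (simp add: I)
qed

section \<open>Storage functions along trajectories\<close>

lemma abs_continuous_storage:
  fixes V :: "('a::euclidean_space) \<times> ('b::euclidean_space) \<times> ('c::euclidean_space) \<Rightarrow> real"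
  assumes "C1 V" and x: "abs_continuous_on_interval a b x" and e: "abs_continuous_on_interval a b e"
  shows "abs_continuous_on_interval a b (\<lambda>t. V (x t, e t, \<theta>))"
proof -
  have "continuous_on {a..b} (\<lambda>t. (x t, e t, \<theta>))"
    using x e by (intro continuous_on_Pair continuous_on_const
        abs_continuous_on_interval_imp_continuous_on)
  then have "bounded ((\<lambda>t. (x t, e t, \<theta>)) ` {a..b})"
    by (intro compact_imp_bounded compact_continuous_image) auto
  with \<open>C1 V\<close> obtain L where L: "\<And>z w. \<lbrakk>z \<in> (\<lambda>t. (x t, e t, \<theta>)) ` {a..b}; w \<in> (\<lambda>t. (x t, e t, \<theta>)) ` {a..b}\<rbrakk>
      \<Longrightarrow> norm (V z - V w) \<le> L * norm (z - w)"
    using C1_lipschitz_on_bounded by blast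
  show ?thesis
  proof (rule abs_continuous_on_interval_dominated[OF x e])
    fix s t assume st: "s \<in> {a..b}" "t \<in> {a..b}"
    have "norm (V (x s, e s, \<theta>) - V (x t, e t, \<theta>)) \<le> L * norm (x s - x t, e s - e t, 0 :: 'c)"
      using L[of "(x s, e s, \<theta>)" "(x t, e t, \<theta>)"] st by auto
    also have "\<dots> \<le> \<bar>L\<bar> * (norm (x s - x t) + norm (e s - e t))"
      using norm_Pair_le[of "x s - x t" "(e s - e t, 0 :: 'c)"]
      by (intro mult_mono) (auto simp: norm_Pair)
    finally show "norm (V (x s, e s, \<theta>) - V (x t, e t, \<theta>))
        \<le> \<bar>L\<bar> * (norm (x s - x t) + norm (e s - e t))" .
  qed
qed

text \<open>
  The total derivative of \<open>V\<close> splits linearly into its restrictions to the \<open>x\<close>- and \<open>e\<close>-directions,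
  which are the two partial derivatives in \<open>V_dot\<close>; the constant parameter direction contributes
  nothing.
\<close>

lemma storage_has_derivative_V_dot:
  fixes V :: "(real^'n) \<times> (real^'n) \<times> 'q::real_normed_vector \<Rightarrow> real"
  assumes "C1 V"
    and x: "(x has_vector_derivative nominal_rhs A B \<theta>s (x t) u) (at t)"
    and e: "(e has_vector_derivative error_rhs A B \<theta>s \<theta> (x t) (e t) u) (at t)"
  shows "((\<lambda>t. V (x t, e t, \<theta>)) has_vector_derivative V_dot A B \<theta>s V (x t) (e t) \<theta> u) (at t)"
proof -
  obtain V' where V': "\<And>z. (V has_derivative blinfun_apply (V' z)) (at z)"
    using \<open>C1 V\<close> unfolding C1_def by blast
  let ?dV = "blinfun_apply (V' (x t, e t, \<theta>))"
  let ?f = "nominal_rhs A B \<theta>s (x t) u" and ?g = "error_rhs A B \<theta>s \<theta> (x t) (e t) u"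
  have "((\<lambda>y. V (y, e t, \<theta>)) has_derivative (\<lambda>h. ?dV (h, 0, 0))) (at (x t))"
    by (rule has_derivative_compose[of "\<lambda>y. (y, e t, \<theta>)", OF _ V'])
       (auto intro!: derivative_eq_intros simp: zero_prod_def)
  from frechet_derivative_at[OF this]
  have fx: "frechet_derivative (\<lambda>y. V (y, e t, \<theta>)) (at (x t)) = (\<lambda>h. ?dV (h, 0, 0))" ..
  have "((\<lambda>y. V (x t, y, \<theta>)) has_derivative (\<lambda>h. ?dV (0, h, 0))) (at (e t))"
    by (rule has_derivative_compose[of "\<lambda>y. (x t, y, \<theta>)", OF _ V'])
       (auto intro!: derivative_eq_intros simp: zero_prod_def)
  from frechet_derivative_at[OF this]
  have fe: "frechet_derivative (\<lambda>y. V (x t, y, \<theta>)) (at (e t)) = (\<lambda>h. ?dV (0, h, 0))" ..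
  have "((\<lambda>t. V (x t, e t, \<theta>)) has_derivative (\<lambda>h. ?dV (h *\<^sub>R ?f, h *\<^sub>R ?g, 0))) (at t)"
    using x e unfolding has_vector_derivative_def
    by (intro has_derivative_compose[of "\<lambda>t. (x t, e t, \<theta>)", OF _ V'] has_derivative_Pair
        has_derivative_const)
  moreover have "?dV (h *\<^sub>R ?f, h *\<^sub>R ?g, 0) = h *\<^sub>R V_dot A B \<theta>s V (x t) (e t) \<theta> u" for h
  proof -
    have "(h *\<^sub>R ?f, h *\<^sub>R ?g, 0) = h *\<^sub>R ((?f, 0, 0) + (0, ?g, 0 :: 'q))"
      by simp
    then show ?thesis
      unfolding V_dot_def fx fe by (simp only: blinfun.scaleR_right blinfun.add_right)
  qed
  ultimately show ?thesis
    unfolding has_vector_derivative_def by simp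
qed

section \<open>Energies on the half-line\<close>

lemma set_borel_measurable_inner_self:
  fixes w :: "'a \<Rightarrow> 'b::euclidean_space"
  assumes "set_borel_measurable M S w"
  shows "set_borel_measurable M S (\<lambda>t. w t \<bullet> w t)"
proof -
  have "(\<lambda>t. (indicator S t *\<^sub>R w t) \<bullet> (indicator S t *\<^sub>R w t)) \<in> borel_measurable M"
    using assms unfolding set_borel_measurable_def by (intro borel_measurable_inner)
  also have "(\<lambda>t. (indicator S t *\<^sub>R w t) \<bullet> (indicator S t *\<^sub>R w t)) = (\<lambda>t. indicator S t *\<^sub>R (w t \<bullet> w t))"
    by (auto simp: indicator_def)
  finally show ?thesis
    unfolding set_borel_measurable_def .
qed

lemma set_borel_measurable_ennreal_indicator:
  assumes "set_borel_measurable M S f"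
  shows "(\<lambda>t. ennreal (f t) * indicator S t) \<in> borel_measurable M"
proof -
  have "(\<lambda>t. ennreal (indicator S t *\<^sub>R f t)) \<in> borel_measurable M"
    using assms unfolding set_borel_measurable_def by measurable
  also have "(\<lambda>t. ennreal (indicator S t *\<^sub>R f t)) = (\<lambda>t. ennreal (f t) * indicator S t)"
    by (auto simp: indicator_def)
  finally show ?thesis .
qed

lemma set_nn_integral_ennreal_cmult:
  assumes "set_borel_measurable M S f" and "0 \<le> c" and "\<And>t. 0 \<le> f t"
  shows "(\<integral>\<^sup>+t\<in>S. ennreal (c * f t) \<partial>M) = ennreal c * (\<integral>\<^sup>+t\<in>S. ennreal (f t) \<partial>M)"
proof -
  have "(\<integral>\<^sup>+t\<in>S. ennreal (c * f t) \<partial>M) = (\<integral>\<^sup>+t. ennreal c * (ennreal (f t) * indicator S t) \<partial>M)"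
    using assms(2,3) by (simp add: ennreal_mult mult.assoc)
  also have "\<dots> = ennreal c * (\<integral>\<^sup>+t\<in>S. ennreal (f t) \<partial>M)"
    by (rule nn_integral_cmult[OF set_borel_measurable_ennreal_indicator[OF assms(1)]])
  finally show ?thesis .
qed

lemma L2_norm_sq_eq_0_imp_zero:
  assumes "set_borel_measurable lebesgue {0..} w" and "L2_norm_sq w = 0"
  shows "zero_in_L2 w"
proof -
  have "AE t in lebesgue. ennreal (w t \<bullet> w t) * indicator {0..} t = 0"
    using assms(2) nn_integral_0_iff_AE[OF set_borel_measurable_ennreal_indicator[OF
        set_borel_measurable_inner_self[OF assms(1)]]]
    unfolding L2_norm_sq_def by simp
  then show ?thesis
    unfolding zero_in_L2_def by eventually_elim (auto simp: indicator_def split: if_splits)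
qed

section \<open>The gain bound\<close>

theorem proposition5:
  fixes A :: "real^'q \<Rightarrow> real^'n^'n"
    and B :: "real^'q \<Rightarrow> real^'m^'n"
    and C :: "real^'q \<Rightarrow> real^'n^'p"
    and D :: "real^'q \<Rightarrow> real^'m^'p"
    and \<Theta> :: "(real^'q) set"
    and \<theta>s :: "real^'q"
    and V :: "(real^'n) \<times> (real^'n) \<times> (real^'q) \<Rightarrow> real"
    and \<gamma>d \<gamma>n :: "real^'q \<Rightarrow> real"
  assumes "\<theta>s \<in> \<Theta>"
    and "\<And>\<theta>. \<theta> \<in> \<Theta> \<Longrightarrow> hurwitz (A \<theta>)"
    and "\<And>x e \<theta>. V (x, e, \<theta>) \<ge> 0"
    and "\<And>\<theta>. V (0, 0, \<theta>) = 0"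
    and "C1 V"
    and "\<And>\<theta>. \<gamma>d \<theta> \<ge> 0"
    and "\<And>\<theta>. \<gamma>n \<theta> \<ge> 0"
    and "\<And>\<theta> x e u. \<theta> \<in> \<Theta> \<Longrightarrow>
           V (x, e, \<theta>) \<ge> 0 \<and>
           V_dot A B \<theta>s V x e \<theta> u
             \<le> - \<gamma>d \<theta> * (output_error C D \<theta>s \<theta> x e u \<bullet> output_error C D \<theta>s \<theta> x e u)
               + \<gamma>n \<theta> * (u \<bullet> u)"
  shows "\<forall>u. in_L2 u \<and> \<not> zero_in_L2 u \<longrightarrow>
           (\<forall>\<theta>\<in>\<Theta>. \<gamma>d \<theta> \<noteq> 0 \<longrightarrow>
             (\<forall>x e \<Delta>y.
                caratheodory_solution (\<lambda>t x. nominal_rhs A B \<theta>s x (u t)) 0 x \<and>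
                caratheodory_solution (\<lambda>t e. error_rhs A B \<theta>s \<theta> (x t) e (u t)) 0 e \<and>
                (\<forall>t\<ge>0. \<Delta>y t = output_error C D \<theta>s \<theta> (x t) (e t) (u t))
                \<longrightarrow> L2_norm_sq \<Delta>y / L2_norm_sq u \<le> ennreal (\<gamma>n \<theta> / \<gamma>d \<theta>)))"
proof (intro allI impI ballI)
  fix u \<theta> x e \<Delta>y
  assume u: "in_L2 u \<and> \<not> zero_in_L2 u" and \<theta>: "\<theta> \<in> \<Theta>" and "\<gamma>d \<theta> \<noteq> 0"
    and sol: "caratheodory_solution (\<lambda>t x. nominal_rhs A B \<theta>s x (u t)) 0 x \<and>
                caratheodory_solution (\<lambda>t e. error_rhs A B \<theta>s \<theta> (x t) e (u t)) 0 e \<and>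
                (\<forall>t\<ge>0. \<Delta>y t = output_error C D \<theta>s \<theta> (x t) (e t) (u t))"
  have \<gamma>d: "0 < \<gamma>d \<theta>"
    using assms(6)[of \<theta>] \<open>\<gamma>d \<theta> \<noteq> 0\<close> by simp
  define \<gamma> where "\<gamma> = \<gamma>n \<theta> / \<gamma>d \<theta>"
  have "0 \<le> \<gamma>"
    using assms(7)[of \<theta>] \<gamma>d by (simp add: \<gamma>_def)
  have sq_meas: "set_borel_measurable lebesgue {0..} (\<lambda>t. u t \<bullet> u t)"
    using u by (intro set_borel_measurable_inner_self) (simp add: in_L2_def)
  \<comment> \<open>Dividing the storage by \<open>\<gamma>d \<theta>\<close> leaves the output energy without a factor, so that no
    constant has to be pulled out of its integral, a step that would require \<open>\<Delta>y\<close> to be measurable.\<close>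
  define W where "W t = V (x t, e t, \<theta>) / \<gamma>d \<theta>" for t
  define W' where "W' t = V_dot A B \<theta>s V (x t) (e t) \<theta> (u t) / \<gamma>d \<theta>" for t
  have "L2_norm_sq \<Delta>y \<le> (\<integral>\<^sup>+t\<in>{0..}. ennreal (\<gamma> * (u t \<bullet> u t)) \<partial>lebesgue)"
    unfolding L2_norm_sq_def
  proof (rule dissipation_inequality[of W _ _ W'])
    show "abs_continuous_on_interval 0 T W" if "0 \<le> T" for T
    proof -
      have ac: "abs_continuous_on_interval 0 T (\<lambda>t. V (x t, e t, \<theta>))"
        using sol that by (intro abs_continuous_storage[OF assms(5)])
          (auto simp: caratheodory_solution_def)
      show ?thesis
        by (rule abs_continuous_on_interval_dominated[where L = "1 / \<gamma>d \<theta>", OF ac ac])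
           (use \<gamma>d in \<open>auto simp: W_def divide_right_mono simp flip: diff_divide_distrib\<close>)
    qed
    show "W 0 = 0"
      using sol assms(4) by (simp add: W_def caratheodory_solution_def)
    show "0 \<le> W t" for t
      using assms(3) \<gamma>d by (simp add: W_def)
    show "set_borel_measurable lebesgue {0..} (\<lambda>t. \<gamma> * (u t \<bullet> u t))"
    proof -
      have "(\<lambda>t. \<gamma> * (indicator {0..} t *\<^sub>R (u t \<bullet> u t))) \<in> borel_measurable lebesgue"
        using sq_meas unfolding set_borel_measurable_def by (rule borel_measurable_times[OF borel_measurable_const])
      then show ?thesis
        by (simp add: set_borel_measurable_def mult.left_commute)
    qed
    have "AE t in lebesgue. 0 < t \<longrightarrow> (x has_vector_derivative nominal_rhs A B \<theta>s (x t) (u t)) (at t)"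
      and "AE t in lebesgue. 0 < t \<longrightarrow> (e has_vector_derivative error_rhs A B \<theta>s \<theta> (x t) (e t) (u t)) (at t)"
      using sol by (auto simp: caratheodory_solution_def)
    then show "AE t in lebesgue. 0 < t \<longrightarrow>
        (W has_vector_derivative W' t) (at t) \<and> \<Delta>y t \<bullet> \<Delta>y t + W' t \<le> \<gamma> * (u t \<bullet> u t)"
    proof eventually_elim
      case (elim t)
      show ?case
      proof (intro impI conjI)
        assume "0 < t"
        from storage_has_derivative_V_dot[OF assms(5)] elim \<open>0 < t\<close>
        have "((\<lambda>t. V (x t, e t, \<theta>)) has_vector_derivative V_dot A B \<theta>s V (x t) (e t) \<theta> (u t)) (at t)"
          by blast
        then show "(W has_vector_derivative W' t) (at t)"
          unfolding W_def W'_def by (rule has_vector_derivative_divide)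
        have "V_dot A B \<theta>s V (x t) (e t) \<theta> (u t) \<le> - \<gamma>d \<theta> * (\<Delta>y t \<bullet> \<Delta>y t) + \<gamma>n \<theta> * (u t \<bullet> u t)"
          using assms(8)[OF \<theta>, of "x t" "e t" "u t"] sol \<open>0 < t\<close> by auto
        then have "(\<gamma>d \<theta> * (\<Delta>y t \<bullet> \<Delta>y t) + V_dot A B \<theta>s V (x t) (e t) \<theta> (u t)) / \<gamma>d \<theta>
            \<le> (\<gamma>n \<theta> * (u t \<bullet> u t)) / \<gamma>d \<theta>"
          using \<gamma>d by (intro divide_right_mono) auto
        then show "\<Delta>y t \<bullet> \<Delta>y t + W' t \<le> \<gamma> * (u t \<bullet> u t)"
          using \<gamma>d by (simp add: W'_def \<gamma>_def add_divide_distrib)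
      qed
    qed
  qed (use \<open>0 \<le> \<gamma>\<close> in auto)
  also have "\<dots> = ennreal \<gamma> * L2_norm_sq u"
    unfolding L2_norm_sq_def using \<open>0 \<le> \<gamma>\<close> by (intro set_nn_integral_ennreal_cmult sq_meas) auto
  finally have gain: "L2_norm_sq \<Delta>y \<le> ennreal \<gamma> * L2_norm_sq u" .
  have "L2_norm_sq u \<noteq> 0"
    using u L2_norm_sq_eq_0_imp_zero[of u] by (auto simp: in_L2_def)
  moreover have "L2_norm_sq u \<noteq> top"
    using u by (auto simp: in_L2_def)
  ultimately show "L2_norm_sq \<Delta>y / L2_norm_sq u \<le> ennreal (\<gamma>n \<theta> / \<gamma>d \<theta>)"
    using gain unfolding \<gamma>_def[symmetric]
    by (intro divide_le_posI_ennreal) (auto simp: zero_less_iff_neq_zero mult.commute)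
qed

end
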